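(* Assume that $\mathcal{A} = (Q,q_0,\delta,F)$ is a simple LWAA. Then $\mathcal{L}(\mathcal{A}) \neq \emptyset$ if and only if there exists a finite run dag $\Delta = e_0 e_1 \ldots e_n$ with configurations $c_0 c_1 \ldots c_{n+1}$ over a finite sequence $s_0 \ldots s_n$ of states and some $k \leq n$ such that (1) $c_k = c_{n+1}$, and (2) for every $q \in F$, one has $q \notin c_j$ for some $j$ where $k \leq j \leq n$.
   Context: Fix a finite set $\mathcal{V}$ of atomic propositions; a state is a subset $s \subseteq \mathcal{V}$, and a temporal structure is a sequence $\sigma = s_0 s_1 \ldots$ of states. A set is identified with the Boolean valuation making true exactly its elements. An alternating $\omega$-automaton $\mathcal{A} = (Q, q_0, \delta, Acc)$ has a finite set of locations $Q$ with $Q \cap \mathcal{V} = \emptyset$, an initial location $q_0 \in Q$, a transition function $\delta$ assigning to each $q \in Q$ a propositional formula $\delta(q)$ over $Q \cup \mathcal{V}$ in which locations occur only positively, and an acceptance condition $Acc \subseteq Q^{\omega}$. Write $q \rightarrow q'$ if $q'$ appears in $\delta(q)$. For a relation $r$, $\mathrm{dom}(r)$ is its domain and $r(A)$ the image of $A$ (with $r(x) = r(\{x\})$). A run dag of $\mathcal{A}$ over $\sigma = s_0 s_1 \ldots$ is a sequence $\Delta = e_0 e_1 \ldots$ of edge sets $e_i \subseteq Q \times Q$, with configurations $c_0 = \{q_0\}$ and $c_{i+1} = e_i(c_i)$, such that for all $i$, $\mathrm{dom}(e_i) \subseteq c_i$ and for all $q \in c_i$ the valuation $s_i \cup e_i(q)$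 satisfies $\delta(q)$; a finite run dag is a finite prefix of a run dag. A path is a sequence $p_0 p_1 \ldots$ with $p_0 = q_0$ and $(p_i,p_{i+1}) \in e_i$. A run dag is accepting iff every infinite path lies in $Acc$, and $\mathcal{L}(\mathcal{A})$ is the set of temporal structures admitting an accepting run dag. A (co-Büchi) linear weak alternating automaton (LWAA) $\mathcal{A} = (Q,q_0,\delta,F)$ is such an automaton with $F \subseteq Q$, where the relation $q' \preceq_{\mathcal{A}} q$ iff $q \rightarrow^* q'$ is a partial order on $Q$, and $Acc$ is the set of sequences $p_0 p_1 \ldots \in Q^{\omega}$ with $p_i \in F$ for only finitely many $i$. An LWAA is simple if for all $q \in F$, all $q' \in Q$, all states $s \subseteq \mathcal{V}$, and all $X, Y \subseteq Q$ not containing $q$: if $s \cup X \cup \{q\} \models \delta(q')$ and $s \cup Y \models \delta(q)$, then $s \cup X \cup Y \models \delta(q')$. *)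

theory Defs
  imports Main "HOL-Library.Omega_Words_Fun"
begin

text \<open>
  Locations and atomic propositions live in one type \<open>'a\<close>; the sets \<open>Q\<close> and \<open>V\<close>
  carve them out and are required to be disjoint.
\<close>

datatype (atoms: 'a) form =
    TT
  | FF
  | Atom 'a
  | Neg "'a form"
  | Conj "'a form" "'a form"
  | Disj "'a form" "'a form"

primrec sat :: "'a set \<Rightarrow> 'a form \<Rightarrow> bool"  (infix "\<Turnstile>" 50) where
  "M \<Turnstile> TT \<longleftrightarrow> True"
| "M \<Turnstile> FF \<longleftrightarrow> False"
| "M \<Turnstile> Atom a \<longleftrightarrow> a \<in> M"
| "M \<Turnstile> Neg f \<longleftrightarrow> \<not> M \<Turnstile> f"
| "M \<Turnstile> Conj f g \<longleftrightarrow> M \<Turnstile> f \<and> M \<Turnstile> g"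
| "M \<Turnstile> Disj f g \<longleftrightarrow> M \<Turnstile> f \<or> M \<Turnstile> g"

text \<open>
  \<open>occurs True f\<close> (\<open>occurs False f\<close>) are the atoms with an occurrence in \<open>f\<close> below an
  even (odd) number of negations.
\<close>

primrec occurs :: "bool \<Rightarrow> 'a form \<Rightarrow> 'a set" where
  "occurs b TT = {}"
| "occurs b FF = {}"
| "occurs b (Atom a) = (if b then {a} else {})"
| "occurs b (Neg f) = occurs (\<not> b) f"
| "occurs b (Conj f g) = occurs b f \<union> occurs b g"
| "occurs b (Disj f g) = occurs b f \<union> occurs b g"

record 'a alt_automaton =
  locs :: "'a set"
  init :: 'a
  trans_fm :: "'a \<Rightarrow> 'a form"
  acc :: "'a word set"

definition alternating_automaton :: "'a set \<Rightarrow> 'a alt_automaton \<Rightarrow> bool" where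
  "alternating_automaton V A \<longleftrightarrow>
     finite (locs A) \<and> locs A \<inter> V = {} \<and> init A \<in> locs A \<and>
     (\<forall>q\<in>locs A. atoms (trans_fm A q) \<subseteq> locs A \<union> V \<and>
                  occurs False (trans_fm A q) \<inter> locs A = {}) \<and>
     acc A \<subseteq> {p. range p \<subseteq> locs A}"

definition temporal_structure :: "'a set \<Rightarrow> 'a set word \<Rightarrow> bool" where
  "temporal_structure V \<sigma> \<longleftrightarrow> (\<forall>i. \<sigma> i \<subseteq> V)"

text \<open>
  The configuration at position \<open>i\<close> depends only on the edge sets \<open>e 0, \<dots>, e (i - 1)\<close>,
  so for a finite edge sequence \<open>es\<close> one uses \<open>config A ((!) es) i\<close> with
  \<open>i \<le> length es\<close>.
\<close>

primrec config :: "'a alt_automaton \<Rightarrow> (nat \<Rightarrow> 'a rel) \<Rightarrow> nat \<Rightarrow> 'a set" where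
  "config A e 0 = {init A}"
| "config A e (Suc i) = e i `` config A e i"

definition run_dag :: "'a alt_automaton \<Rightarrow> 'a set word \<Rightarrow> 'a rel word \<Rightarrow> bool" where
  "run_dag A \<sigma> e \<longleftrightarrow>
     (\<forall>i. e i \<subseteq> locs A \<times> locs A \<and> Domain (e i) \<subseteq> config A e i \<and>
          (\<forall>q\<in>config A e i. \<sigma> i \<union> e i `` {q} \<Turnstile> trans_fm A q))"

definition finite_run_dag ::
    "'a set \<Rightarrow> 'a alt_automaton \<Rightarrow> 'a set list \<Rightarrow> 'a rel list \<Rightarrow> bool" where
  "finite_run_dag V A ss es \<longleftrightarrow>
     (\<exists>\<sigma> e m. temporal_structure V \<sigma> \<and> run_dag A \<sigma> e \<and> ss = prefix m \<sigma> \<and> es = prefix m e)"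

definition infinite_path :: "'a alt_automaton \<Rightarrow> 'a rel word \<Rightarrow> 'a word \<Rightarrow> bool" where
  "infinite_path A e p \<longleftrightarrow> p 0 = init A \<and> (\<forall>i. (p i, p (Suc i)) \<in> e i)"

definition accepting :: "'a alt_automaton \<Rightarrow> 'a rel word \<Rightarrow> bool" where
  "accepting A e \<longleftrightarrow> (\<forall>p. infinite_path A e p \<longrightarrow> p \<in> acc A)"

definition language :: "'a set \<Rightarrow> 'a alt_automaton \<Rightarrow> 'a set word set" where
  "language V A = {\<sigma>. temporal_structure V \<sigma> \<and> (\<exists>e. run_dag A \<sigma> e \<and> accepting A e)}"

definition succ_rel :: "'a alt_automaton \<Rightarrow> 'a rel" where
  "succ_rel A = {(q, q'). q \<in> locs A \<and> q' \<in> locs A \<and> q' \<in> atoms (trans_fm A q)}"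

text \<open>\<open>(q', q) \<in> loc_order A\<close> iff \<open>q'\<close> is reachable from \<open>q\<close>.\<close>

definition loc_order :: "'a alt_automaton \<Rightarrow> 'a rel" where
  "loc_order A = {(q', q). q \<in> locs A \<and> q' \<in> locs A \<and> (q, q') \<in> (succ_rel A)\<^sup>*}"

definition co_buchi ::
    "'a set \<Rightarrow> 'a \<Rightarrow> ('a \<Rightarrow> 'a form) \<Rightarrow> 'a set \<Rightarrow> 'a alt_automaton" where
  "co_buchi Q q0 \<delta> F =
     \<lparr>locs = Q, init = q0, trans_fm = \<delta>,
      acc = {p. range p \<subseteq> Q \<and> finite {i. p i \<in> F}}\<rparr>"

definition lwaa ::
    "'a set \<Rightarrow> 'a set \<Rightarrow> 'a \<Rightarrow> ('a \<Rightarrow> 'a form) \<Rightarrow> 'a set \<Rightarrow> bool" where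
  "lwaa V Q q0 \<delta> F \<longleftrightarrow>
     alternating_automaton V (co_buchi Q q0 \<delta> F) \<and> F \<subseteq> Q \<and>
     partial_order_on Q (loc_order (co_buchi Q q0 \<delta> F))"

definition simple_lwaa ::
    "'a set \<Rightarrow> 'a set \<Rightarrow> 'a \<Rightarrow> ('a \<Rightarrow> 'a form) \<Rightarrow> 'a set \<Rightarrow> bool" where
  "simple_lwaa V Q q0 \<delta> F \<longleftrightarrow>
     lwaa V Q q0 \<delta> F \<and>
     (\<forall>q\<in>F. \<forall>q'\<in>Q. \<forall>s X Y. s \<subseteq> V \<longrightarrow> X \<subseteq> Q \<longrightarrow> Y \<subseteq> Q \<longrightarrow> q \<notin> X \<longrightarrow> q \<notin> Y \<longrightarrow>
        s \<union> X \<union> {q} \<Turnstile> \<delta> q' \<longrightarrow> s \<union> Y \<Turnstile> \<delta> q \<longrightarrow> s \<union> X \<union> Y \<Turnstile> \<delta> q')"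

end

theory Submission
  imports Defs
begin

text \<open>
  Edges to locations not occurring in the transition formula can be dropped, after which every path
  descends in the location order and hence is eventually constant. So a run dag missing every
  \<open>q \<in> F\<close> infinitely often yields an accepting one; unrolling the loop \<open>c\<^sub>k \<dots> c\<^bsub>n+1\<^esub>\<close> provides
  such a run dag. Conversely, in an accepting run dag each \<open>q \<in> F\<close> present from some point on lacks
  its self-loop at infinitely many levels. At such a level simplicity allows every edge into \<open>q\<close> to
  be replaced by the edges leaving \<open>q\<close>, which removes \<open>q\<close> from the next configuration without adding
  any location to it. Since there are finitely many configurations, some configuration then recurs
  after every \<open>q \<in> F\<close> has been missed.
\<close>

section \<open>Configurations, paths and run dags\<close>

lemma sat_cong: "M \<inter> atoms f = N \<inter> atoms f \<Longrightarrow> M \<Turnstile> f \<longleftrightarrow> N \<Turnstile> f"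
  by (induction f) (simp_all, blast+)

lemma co_buchi_simps [simp]:
  "locs (co_buchi Q q0 \<delta> F) = Q"
  "init (co_buchi Q q0 \<delta> F) = q0"
  "trans_fm (co_buchi Q q0 \<delta> F) = \<delta>"
  "acc (co_buchi Q q0 \<delta> F) = {p. range p \<subseteq> Q \<and> finite {i. p i \<in> F}}"
  by (simp_all add: co_buchi_def)

lemma config_cong: "(\<And>j. j < i \<Longrightarrow> e j = f j) \<Longrightarrow> config A e i = config A f i"
  by (induction i) auto

lemma config_nth_prefix: "i \<le> m \<Longrightarrow> config A ((!) (prefix m e)) i = config A e i"
  by (intro config_cong) simp

lemma config_mono: "(\<And>j. e j \<subseteq> f j) \<Longrightarrow> config A e i \<subseteq> config A f i"
  by (induction i) (simp_all, blast)

lemma config_subset_locs: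
  assumes "run_dag A \<sigma> e" "init A \<in> locs A"
  shows "config A e i \<subseteq> locs A"
  using assms by (induction i) (auto simp: run_dag_def)

lemma config_path_prefix:
  "q \<in> config A e i \<Longrightarrow> \<exists>p. p 0 = init A \<and> p i = q \<and> (\<forall>j<i. (p j, p (Suc j)) \<in> e j)"
proof (induction i arbitrary: q)
  case 0
  then show ?case by auto
next
  case (Suc i)
  then obtain q' where q': "q' \<in> config A e i" "(q', q) \<in> e i" by auto
  then obtain p where "p 0 = init A" "p i = q'" "\<forall>j<i. (p j, p (Suc j)) \<in> e j"
    using Suc.IH by blast
  with q' show ?case
    by (intro exI[of _ "p(Suc i := q)"]) (auto simp: less_Suc_eq)
qed

lemma infinite_path_in_config:
  assumes "infinite_path A e p"
  shows "p i \<in> config A e i"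
  using assms by (induction i) (auto simp: infinite_path_def)

lemma infinite_path_mono:
  "infinite_path A e p \<Longrightarrow> (\<And>i. e i \<subseteq> f i) \<Longrightarrow> infinite_path A f p"
  by (auto simp: infinite_path_def)

text \<open>A run dag requires \<open>Domain (e i) \<subseteq> config A e i\<close>. Cutting edges
  with unreachable sources enforces this without changing any configuration, so edge sets can be
  modified freely first and repaired afterwards.\<close>

definition reachable_edges :: "'a alt_automaton \<Rightarrow> 'a rel word \<Rightarrow> 'a rel word" where
  "reachable_edges A e i = e i \<inter> config A e i \<times> UNIV"

lemma config_reachable_edges [simp]: "config A (reachable_edges A e) = config A e"
proof
  show "config A (reachable_edges A e) i = config A e i" for i
    by (induction i) (auto simp: reachable_edges_def)
qed

lemma run_dag_reachable_edges:
  assumes "\<And>i. e i \<subseteq> locs A \<times> locs A"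
    and "\<And>i q. q \<in> config A e i \<Longrightarrow> \<sigma> i \<union> e i `` {q} \<Turnstile> trans_fm A q"
  shows "run_dag A \<sigma> (reachable_edges A e)"
proof -
  have "reachable_edges A e i `` {q} = e i `` {q}" if "q \<in> config A e i" for q i
    using that by (auto simp: reachable_edges_def)
  with assms show ?thesis
    unfolding run_dag_def by (auto simp: reachable_edges_def)
qed

section \<open>Descending run dags and co-Buchi acceptance\<close>

lemma finite_loc_order: "finite (locs A) \<Longrightarrow> finite (loc_order A)"
  by (rule finite_subset[of _ "locs A \<times> locs A"]) (auto simp: loc_order_def)

lemma succ_rel_subset_loc_order: "(succ_rel A)\<inverse> \<subseteq> loc_order A"
  by (auto simp: loc_order_def succ_rel_def)

text \<open>Passing to fewer edges only shrinks configurations, so the formulas to be satisfied are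
  among the old ones. By \<open>f i \<subseteq> e i\<close>, paths of \<open>f\<close> are paths of
  \<open>e\<close>, and locations missed by \<open>e\<close> stay missed.\<close>

lemma run_dag_descending:
  assumes "alternating_automaton V A" and \<sigma>: "temporal_structure V \<sigma>" and e: "run_dag A \<sigma> e"
  obtains f where "run_dag A \<sigma> f" "\<And>i. f i \<subseteq> e i" "\<And>i. f i \<subseteq> (loc_order A)\<inverse>"
proof
  define g where "g = (\<lambda>i. e i \<inter> succ_rel A)"
  have "\<sigma> i \<union> g i `` {q} \<Turnstile> trans_fm A q" if q: "q \<in> config A g i" for i q
  proof -
    have "q \<in> config A e i"
      using q config_mono[of g e A i] by (auto simp: g_def)
    moreover have "q \<in> locs A"
      using calculation config_subset_locs[OF e] assms(1) by (auto simp: alternating_automaton_def)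
    ultimately have "(\<sigma> i \<union> g i `` {q}) \<inter> atoms (trans_fm A q)
        = (\<sigma> i \<union> e i `` {q}) \<inter> atoms (trans_fm A q)"
      using e by (auto simp: g_def succ_rel_def run_dag_def)
    then have "\<sigma> i \<union> g i `` {q} \<Turnstile> trans_fm A q \<longleftrightarrow> \<sigma> i \<union> e i `` {q} \<Turnstile> trans_fm A q"
      by (rule sat_cong)
    with \<open>q \<in> config A e i\<close> e show ?thesis
      by (simp add: run_dag_def)
  qed
  then show "run_dag A \<sigma> (reachable_edges A g)"
    by (rule run_dag_reachable_edges[rotated]) (use e in \<open>auto simp: g_def run_dag_def\<close>)
  show "reachable_edges A g i \<subseteq> e i" "reachable_edges A g i \<subseteq> (loc_order A)\<inverse>" for i
    using succ_rel_subset_loc_order by (auto simp: g_def reachable_edges_def)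
qed

text \<open>The strict part of \<open>r\<close> is finite and acyclic, hence well-founded. Once
  \<open>p\<close> attains a minimal value of its range, it cannot leave it.\<close>

lemma descending_eventually_constant:
  fixes p :: "nat \<Rightarrow> 'a"
  assumes "finite r" "trans r" "antisym r" and desc: "\<And>i. (p (Suc i), p i) \<in> r"
  obtains i where "\<And>j. j \<ge> i \<Longrightarrow> p j = p i"
proof -
  have "wf (r - Id)"
  proof (rule finite_acyclic_wf)
    show "acyclic (r - Id)"
      using assms by (metis acyclic_irrefl irrefl_diff_Id trancl_id trans_diff_Id)
  qed (use assms in simp)
  then obtain x where x: "x \<in> range p" "\<And>y. (y, x) \<in> r - Id \<Longrightarrow> y \<notin> range p"
    by (rule wfE_min[of _ "p 0" "range p"]) auto
  then obtain i where i: "\<And>j. (p j, p i) \<in> r - Id \<Longrightarrow> False"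
    by blast
  have "p (i + d) = p i" for d
  proof (induction d)
    case (Suc d)
    then show ?case
      using i[of "Suc (i + d)"] desc[of "i + d"] by auto
  qed simp
  with that[of i] show thesis
    by (metis le_Suc_ex)
qed

text \<open>This replaces acceptance, a condition on infinite paths, by one on configurations alone,
  which a loop can guarantee.\<close>

lemma language_nonemptyI:
  assumes "lwaa V Q q0 \<delta> F"
    and \<sigma>: "temporal_structure V \<sigma>"
    and e: "run_dag (co_buchi Q q0 \<delta> F) \<sigma> e"
    and miss: "\<And>q i. q \<in> F \<Longrightarrow> \<exists>j\<ge>i. q \<notin> config (co_buchi Q q0 \<delta> F) e j"
  shows "language V (co_buchi Q q0 \<delta> F) \<noteq> {}"
proof -
  let ?A = "co_buchi Q q0 \<delta> F"
  have A: "alternating_automaton V ?A" "partial_order_on Q (loc_order ?A)" "finite Q"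
    using assms by (auto simp: lwaa_def alternating_automaton_def)
  obtain f where f: "run_dag ?A \<sigma> f" "\<And>i. f i \<subseteq> e i" "\<And>i. f i \<subseteq> (loc_order ?A)\<inverse>"
    using run_dag_descending[OF A(1) \<sigma> e] by blast
  have "p \<in> acc ?A" if p: "infinite_path ?A f p" for p
  proof -
    have step: "(p i, p (Suc i)) \<in> f i" for i
      using p by (simp add: infinite_path_def)
    have pQ: "p i \<in> Q" for i
      using step[of i] f(1) by (auto simp: run_dag_def)
    obtain i where i: "\<And>j. j \<ge> i \<Longrightarrow> p j = p i"
    proof -
      have "finite (loc_order ?A)"
        using A(3) by (simp add: finite_loc_order)
      moreover have "trans (loc_order ?A)" "antisym (loc_order ?A)"
        using A(2) by (auto simp: partial_order_on_def preorder_on_def)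
      moreover have "(p (Suc i), p i) \<in> loc_order ?A" for i
        using step f(3) by blast
      ultimately show thesis
        by (rule descending_eventually_constant[OF _ _ _ _ that])
    qed
    \<comment> \<open>A limit location in \<open>F\<close> would lie in all later configurations of
      \<open>f\<close>, hence of \<open>e\<close>, against \<open>miss\<close>.\<close>
    have "p i \<notin> F"
    proof
      assume "p i \<in> F"
      then obtain j where j: "j \<ge> i" "p i \<notin> config ?A e j"
        using miss by blast
      then show False
        using i[of j] infinite_path_in_config[OF p, of j] config_mono[of f e ?A j] f(2) by auto
    qed
    have "j < i" if "p j \<in> F" for j
      using \<open>p i \<notin> F\<close> i[of j] that by (cases "i \<le> j") auto
    then have "{j. p j \<in> F} \<subseteq> {..<i}"
      by auto
    then have "finite {j. p j \<in> F}"
      by (rule finite_subset) simp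
    with pQ show ?thesis
      by auto
  qed
  with f(1) \<sigma> show ?thesis
    by (auto simp: language_def accepting_def)
qed

section \<open>Unrolling a loop of configurations\<close>

definition lasso_index :: "nat \<Rightarrow> nat \<Rightarrow> nat \<Rightarrow> nat" where
  "lasso_index k n i = (if i < k then i else k + (i - k) mod (Suc n - k))"

lemma lasso_index_0: "lasso_index k n 0 = 0"
  by (simp add: lasso_index_def)

lemma lasso_index_Suc:
  assumes "k \<le> n"
  shows "lasso_index k n (Suc i)
    = (if lasso_index k n i = n then k else Suc (lasso_index k n i))"
  using assms by (auto simp: lasso_index_def Suc_diff_le mod_Suc)

lemma lasso_index_recurs:
  assumes "k \<le> j" "j \<le> n"
  obtains i where "i \<ge> m" "lasso_index k n i = j"
proof
  \<comment> \<open>The witness is \<open>j\<close> shifted by \<open>m\<close> periods. The period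
    is positive since \<open>k \<le> n\<close>, so the shift is at least \<open>m\<close>.\<close>
  show "j + m * (Suc n - k) \<ge> m"
    using assms by (cases "Suc n - k") auto
  have "j + m * (Suc n - k) - k = (j - k) + m * (Suc n - k)"
    using assms by simp
  then have "(j + m * (Suc n - k) - k) mod (Suc n - k) = j - k"
    using assms by (simp only: mod_mult_self1) simp
  then show "lasso_index k n (j + m * (Suc n - k)) = j"
    using assms by (simp add: lasso_index_def)
qed

text \<open>The index leaves its normal course only when jumping from \<open>n\<close> back to
  \<open>k\<close>. There the next configuration would be that at \<open>Suc n\<close>, which equals
  that at \<open>k\<close>.\<close>

lemma config_lasso:
  assumes "k \<le> n" and "config A e k = config A e (Suc n)"
  shows "config A (e \<circ> lasso_index k n) i = config A e (lasso_index k n i)"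
  using assms by (induction i) (auto simp: lasso_index_0 lasso_index_Suc)

lemma run_dag_lasso:
  assumes "run_dag A \<sigma> e" and "k \<le> n" and "config A e k = config A e (Suc n)"
  shows "run_dag A (\<sigma> \<circ> lasso_index k n) (e \<circ> lasso_index k n)"
  using assms by (simp add: run_dag_def config_lasso)

section \<open>Avoiding locations of \<open>F\<close> by simplicity\<close>

lemma simple_lwaa_bypass:
  assumes simple: "simple_lwaa V Q q0 \<delta> F" and "s \<subseteq> V" and "C \<subseteq> Q"
    and g: "g \<subseteq> (loc_order (co_buchi Q q0 \<delta> F))\<inverse>"
    and sat: "\<And>q. q \<in> C \<Longrightarrow> s \<union> g `` {q} \<Turnstile> \<delta> q"
    and "finite L" "L \<subseteq> F \<inter> C" and "\<And>q. q \<in> L \<Longrightarrow> (q, q) \<notin> g"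
  shows "\<exists>h \<subseteq> (loc_order (co_buchi Q q0 \<delta> F))\<inverse>.
    (\<forall>q\<in>C. s \<union> h `` {q} \<Turnstile> \<delta> q) \<and> h `` C \<subseteq> g `` C - L \<and> h \<inter> Id \<subseteq> g"
  using assms(6-)
\<comment> \<open>The locations of \<open>L\<close> are bypassed one at a time. The invariant
  \<open>h \<inter> Id \<subseteq> g\<close> ensures that the next one still has no
  self-loop.\<close>
proof (induction L rule: finite_induct)
  case empty
  then show ?case using g sat by auto
next
  case (insert a L)
  let ?r = "loc_order (co_buchi Q q0 \<delta> F)"
  have r: "trans ?r" "antisym ?r"
    using simple
    by (auto simp: simple_lwaa_def lwaa_def partial_order_on_def preorder_on_def)
  obtain h where h: "h \<subseteq> ?r\<inverse>" "\<And>q. q \<in> C \<Longrightarrow> s \<union> h `` {q} \<Turnstile> \<delta> q"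
      "h `` C \<subseteq> g `` C - L" "h \<inter> Id \<subseteq> g"
    using insert by auto
  have a: "a \<in> F" "a \<in> C" "(a, a) \<notin> h"
    using insert.prems h(4) by auto
  have hQ: "h `` {q} \<subseteq> Q" for q
    using h(1) by (auto simp: loc_order_def)
  \<comment> \<open>Edges into \<open>a\<close> are composed with those leaving \<open>a\<close>;
    all others are kept. Since \<open>a\<close> has no self-loop in \<open>h\<close>, no edge of
    \<open>h'\<close> ends in \<open>a\<close>.\<close>
  define h' where "h' = {(x, y). (x, y) \<in> h \<and> y \<noteq> a \<or> (x, a) \<in> h \<and> (a, y) \<in> h}"
  have "h' \<subseteq> ?r\<inverse>"
    using h(1) r(1) unfolding h'_def trans_def by blast
  moreover have "s \<union> h' `` {q} \<Turnstile> \<delta> q" if q: "q \<in> C" for q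
  proof (cases "(q, a) \<in> h")
    case True
    \<comment> \<open>Simplicity is applied with X the \<open>h\<close>-successors of
      \<open>q\<close> other than \<open>a\<close>, and Y the \<open>h\<close>-successors of
      \<open>a\<close>.\<close>
    have "s \<union> (h `` {q} - {a}) \<union> {a} = s \<union> h `` {q}"
      using True by auto
    then have "s \<union> (h `` {q} - {a}) \<union> {a} \<Turnstile> \<delta> q"
      using h(2)[OF q] by simp
    moreover have "s \<union> h `` {a} \<Turnstile> \<delta> a"
      using h(2) a by blast
    moreover have "q \<in> Q" "h `` {q} - {a} \<subseteq> Q" "a \<notin> h `` {a}"
      using q \<open>C \<subseteq> Q\<close> hQ[of q] a by auto
    ultimately have "s \<union> (h `` {q} - {a}) \<union> h `` {a} \<Turnstile> \<delta> q"
      using simple \<open>s \<subseteq> V\<close> a(1) hQ[of a] unfolding simple_lwaa_def by blast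
    moreover have "h' `` {q} = (h `` {q} - {a}) \<union> h `` {a}"
      using True by (auto simp: h'_def)
    ultimately show ?thesis
      by (simp add: Un_assoc)
  next
    case False
    then have "h' `` {q} = h `` {q}"
      by (auto simp: h'_def)
    then show ?thesis
      using h(2)[OF q] by simp
  qed
  \<comment> \<open>As \<open>a \<in> C\<close>, the successors of \<open>a\<close> already belong
    to the image of \<open>C\<close> under \<open>h\<close>, so no new target arises.\<close>
  moreover have "h' `` C \<subseteq> g `` C - insert a L"
    using h(3) a by (auto simp: h'_def)
  moreover have "h' \<inter> Id \<subseteq> g"
    \<comment> \<open>By antisymmetry a new self-loop could only arise at \<open>a\<close>, which has none in \<open>h\<close>.\<close>
    using h(1,4) r(2) a(3) unfolding h'_def antisym_def by blast
  ultimately show ?case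
    by blast
qed

text \<open>Acceptance alone does not give the last property: a location of \<open>F\<close> may be
  re-entered at every level by different paths. Hence the levels are rebuilt.\<close>

lemma language_nonemptyE:
  assumes simple: "simple_lwaa V Q q0 \<delta> F" and "language V (co_buchi Q q0 \<delta> F) \<noteq> {}"
  obtains \<sigma> e where "temporal_structure V \<sigma>" "run_dag (co_buchi Q q0 \<delta> F) \<sigma> e"
    "\<And>q i. q \<in> F \<Longrightarrow> \<exists>j\<ge>i. q \<notin> config (co_buchi Q q0 \<delta> F) e j"
proof -
  let ?A = "co_buchi Q q0 \<delta> F"
  have A: "alternating_automaton V ?A" "finite Q" "F \<subseteq> Q" "init ?A \<in> locs ?A"
    using simple by (auto simp: simple_lwaa_def lwaa_def alternating_automaton_def)
  obtain \<sigma> e0 where \<sigma>: "temporal_structure V \<sigma>" and e0: "run_dag ?A \<sigma> e0" "accepting ?A e0"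
    using assms(2) by (auto simp: language_def)
  obtain e where e: "run_dag ?A \<sigma> e" "\<And>i. e i \<subseteq> e0 i" "\<And>i. e i \<subseteq> (loc_order ?A)\<inverse>"
    using run_dag_descending[OF A(1) \<sigma> e0(1)] by blast
  have accepting: "p \<in> acc ?A" if "infinite_path ?A e p" for p
    using infinite_path_mono[OF that e(2)] e0(2) by (auto simp: accepting_def)
  define L where "L i = {q \<in> F \<inter> config ?A e i. (q, q) \<notin> e i}" for i
  define bypass where "bypass i h \<longleftrightarrow> h \<subseteq> (loc_order ?A)\<inverse> \<and>
    (\<forall>q\<in>config ?A e i. \<sigma> i \<union> h `` {q} \<Turnstile> \<delta> q) \<and>
    h `` config ?A e i \<subseteq> e i `` config ?A e i - L i \<and> h \<inter> Id \<subseteq> e i" for i h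
  have "\<exists>h. bypass i h" for i
    unfolding bypass_def
  proof (rule simple_lwaa_bypass[OF simple])
    show "\<sigma> i \<subseteq> V"
      using \<sigma> by (simp add: temporal_structure_def)
    show "config ?A e i \<subseteq> Q"
      using config_subset_locs[OF e(1) A(4)] by simp
    show "\<sigma> i \<union> e i `` {q} \<Turnstile> \<delta> q" if "q \<in> config ?A e i" for q
      using e(1) that by (auto simp: run_dag_def)
    show "finite (L i)"
      using A(2,3) by (auto simp: L_def intro: finite_subset)
  qed (use e(3) in \<open>auto simp: L_def\<close>)
  then obtain h where "\<And>i. bypass i (h i)"
    by metis
  then have h: "\<And>i. h i \<subseteq> (loc_order ?A)\<inverse>"
      "\<And>i q. q \<in> config ?A e i \<Longrightarrow> \<sigma> i \<union> h i `` {q} \<Turnstile> \<delta> q"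
      "\<And>i. h i `` config ?A e i \<subseteq> config ?A e (Suc i) - L i"
    by (simp_all add: bypass_def)
  \<comment> \<open>Each \<open>h i\<close> was chosen for the configuration of \<open>e\<close>,
    independently of the other levels. The inclusion transfers its properties to the smaller
    configuration of \<open>h\<close>.\<close>
  have sub: "config ?A h i \<subseteq> config ?A e i" for i
  proof (induction i)
    case (Suc i)
    then have "h i `` config ?A h i \<subseteq> h i `` config ?A e i"
      by blast
    with h(3)[of i] show ?case
      unfolding config.simps by blast
  qed simp
  have "run_dag ?A \<sigma> (reachable_edges ?A h)"
  proof (rule run_dag_reachable_edges)
    show "h i \<subseteq> locs ?A \<times> locs ?A" for i
      using h(1)[of i] by (auto simp: loc_order_def)
  qed (use h(2) sub in auto)
  moreover have "\<exists>j\<ge>i. q \<notin> config ?A (reachable_edges ?A h) j" if "q \<in> F" for q i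
  proof (rule ccontr)
    assume "\<not> ?thesis"
    then have stay: "q \<in> config ?A h j" if "j \<ge> i" for j
      using that by simp
    have loop: "(q, q) \<in> e j" if "j \<ge> i" for j
    proof -
      have "q \<notin> L j"
        using stay[of "Suc j"] that h(3)[of j] sub[of j] by auto
      then show ?thesis
        using stay[OF that] sub \<open>q \<in> F\<close> by (auto simp: L_def)
    qed
    obtain p where p: "p 0 = init ?A" "p i = q" "\<forall>j<i. (p j, p (Suc j)) \<in> e j"
      using config_path_prefix[of q ?A e i] stay[of i] sub[of i] by blast
    \<comment> \<open>A path of \<open>e\<close> that reaches \<open>q\<close> at position
      \<open>i\<close> and then follows self-loops forever contradicts acceptance.\<close>
    define p' where "p' j = (if j < i then p j else q)" for j
    have "(p' j, p' (Suc j)) \<in> e j" for j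
      using p(2,3) loop[of j] by (cases "Suc j" i rule: linorder_cases) (auto simp: p'_def)
    moreover have "p' 0 = init ?A"
      using p(1,2) by (auto simp: p'_def)
    ultimately have "finite {j. p' j \<in> F}"
      using accepting[of p'] by (simp add: infinite_path_def)
    moreover have "{i..} \<subseteq> {j. p' j \<in> F}"
      using \<open>q \<in> F\<close> by (auto simp: p'_def)
    ultimately show False
      using infinite_Ici finite_subset by blast
  qed
  ultimately show thesis
    using that \<sigma> by blast
qed

section \<open>Recurring configurations and the equivalence\<close>

lemma recurring_value:
  fixes c :: "nat \<Rightarrow> 'b"
  assumes "finite (range c)"
  obtains k where "\<And>m. \<exists>n\<ge>m. c n = c k"
proof -
  obtain k where "infinite {n \<in> UNIV. c n = c k}"
    using pigeonhole_infinite[of UNIV c] assms by auto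
  then show thesis
    using that[of k] by (auto simp: infinite_nat_iff_unbounded_le)
qed

lemma finite_bounded_witnesses:
  fixes P :: "'b \<Rightarrow> nat \<Rightarrow> bool"
  assumes "finite S" "\<And>q. q \<in> S \<Longrightarrow> \<exists>j\<ge>k. P q j"
  obtains N where "\<And>q. q \<in> S \<Longrightarrow> \<exists>j\<ge>k. j \<le> N \<and> P q j"
proof -
  obtain w where "\<And>q. q \<in> S \<Longrightarrow> k \<le> w q \<and> P q (w q)"
    using assms(2) by metis
  with assms(1) that[of "Max (w ` S)"] show thesis
    by (meson Max_ge finite_imageI imageI)
qed

theorem theorem2:
  fixes V Q F :: "'a set" and q0 :: 'a and \<delta> :: "'a \<Rightarrow> 'a form"
  assumes "finite V"
    and "simple_lwaa V Q q0 \<delta> F"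
  shows "language V (co_buchi Q q0 \<delta> F) \<noteq> {} \<longleftrightarrow>
    (\<exists>n ss es k.
       finite_run_dag V (co_buchi Q q0 \<delta> F) ss es \<and>
       length ss = n + 1 \<and> length es = n + 1 \<and> k \<le> n \<and>
       config (co_buchi Q q0 \<delta> F) ((!) es) k = config (co_buchi Q q0 \<delta> F) ((!) es) (n + 1) \<and>
       (\<forall>q\<in>F. \<exists>j. k \<le> j \<and> j \<le> n \<and> q \<notin> config (co_buchi Q q0 \<delta> F) ((!) es) j))"
    (is "?L \<longleftrightarrow> ?R")
proof
  let ?A = "co_buchi Q q0 \<delta> F"
  assume ?L
  obtain \<sigma> e where e: "temporal_structure V \<sigma>" "run_dag ?A \<sigma> e"
    and miss: "\<And>q i. q \<in> F \<Longrightarrow> \<exists>j\<ge>i. q \<notin> config ?A e j"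
    using language_nonemptyE[OF assms(2) \<open>?L\<close>] by blast
  have Q: "finite Q" "F \<subseteq> Q" "init ?A \<in> locs ?A"
    using assms(2) by (auto simp: simple_lwaa_def lwaa_def alternating_automaton_def)
  have "range (config ?A e) \<subseteq> Pow Q"
    using config_subset_locs[OF e(2) Q(3)] by auto
  then have "finite (range (config ?A e))"
    by (rule finite_subset) (simp add: Q(1))
  then obtain k where k: "\<And>m. \<exists>n\<ge>m. config ?A e n = config ?A e k"
    by (rule recurring_value) blast
  have "finite F"
    using Q(1,2) by (rule finite_subset[rotated])
  then obtain N where N: "\<And>q. q \<in> F \<Longrightarrow> \<exists>j\<ge>k. j \<le> N \<and> q \<notin> config ?A e j"
    using finite_bounded_witnesses[of F k "\<lambda>q j. q \<notin> config ?A e j", OF _ miss] by blast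
  \<comment> \<open>The recurrence is taken at a successor position beyond both \<open>k\<close> and
    \<open>N\<close>, so every miss at some \<open>j \<le> N\<close> falls within the loop from
    \<open>k\<close> to \<open>n\<close>.\<close>
  obtain n where n: "Suc (max k N) \<le> Suc n" "config ?A e (Suc n) = config ?A e k"
    using k by (metis Suc_le_D)
  have "finite_run_dag V ?A (prefix (n + 1) \<sigma>) (prefix (n + 1) e)"
    using e unfolding finite_run_dag_def by blast
  moreover have "\<exists>j. k \<le> j \<and> j \<le> n \<and> q \<notin> config ?A ((!) (prefix (n + 1) e)) j"
    if "q \<in> F" for q
  proof -
    obtain j where "k \<le> j" "j \<le> N" "q \<notin> config ?A e j"
      using N \<open>q \<in> F\<close> by blast
    moreover have "j \<le> n"
      using n(1) \<open>j \<le> N\<close> by simp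
    ultimately show ?thesis
      using config_nth_prefix[of j "n + 1" ?A e] by (intro exI[of _ j]) simp
  qed
  moreover have "config ?A ((!) (prefix (n + 1) e)) k
      = config ?A ((!) (prefix (n + 1) e)) (n + 1)"
    using n config_nth_prefix[of k "n + 1" ?A e] config_nth_prefix[of "n + 1" "n + 1" ?A e] by simp
  ultimately show ?R
    using n(1)
    by (intro exI[of _ n] exI[of _ "prefix (n + 1) \<sigma>"] exI[of _ "prefix (n + 1) e"] exI[of _ k])
      simp
next
  let ?A = "co_buchi Q q0 \<delta> F"
  assume ?R
  \<comment> \<open>By definition the finite run dag extends to an infinite one; its unrolling reads
    only positions up to \<open>n\<close>.\<close>
  then obtain n \<sigma> e k where e: "temporal_structure V \<sigma>" "run_dag ?A \<sigma> e"
    and "k \<le> n"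
    and loop: "config ?A ((!) (prefix (n + 1) e)) k = config ?A ((!) (prefix (n + 1) e)) (n + 1)"
    and miss: "\<forall>q\<in>F. \<exists>j. k \<le> j \<and> j \<le> n \<and> q \<notin> config ?A ((!) (prefix (n + 1) e)) j"
    unfolding finite_run_dag_def by (auto simp del: config.simps)
  from loop \<open>k \<le> n\<close> have loop': "config ?A e k = config ?A e (Suc n)"
    using config_nth_prefix[of k "n + 1" ?A e] config_nth_prefix[of "n + 1" "n + 1" ?A e]
    by simp
  have lwaa: "lwaa V Q q0 \<delta> F"
    using assms(2) by (simp add: simple_lwaa_def)
  show ?L
  proof (rule language_nonemptyI[OF lwaa _ run_dag_lasso[OF e(2) \<open>k \<le> n\<close> loop']])
    show "temporal_structure V (\<sigma> \<circ> lasso_index k n)"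
      using e(1) by (simp add: temporal_structure_def)
  next
    fix q i
    assume "q \<in> F"
    then obtain j where "k \<le> j" "j \<le> n" "q \<notin> config ?A ((!) (prefix (n + 1) e)) j"
      using miss by blast
    then have "q \<notin> config ?A e j"
      using config_nth_prefix[of j "n + 1" ?A e] by simp
    moreover obtain m where "m \<ge> i" "lasso_index k n m = j"
      using lasso_index_recurs \<open>k \<le> j\<close> \<open>j \<le> n\<close> by blast
    ultimately show "\<exists>j\<ge>i. q \<notin> config ?A (e \<circ> lasso_index k n) j"
      using config_lasso[OF \<open>k \<le> n\<close> loop'] by auto
  qed
qed

end
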